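(* Let $d$ be a positive integer, let $B\subset\mathcal{P}(n,d)$ be a Borel set and $N=\mathcal{P}(n,d)\setminus B$, and suppose that $\vert N_0\vert = d$ and $N_j=\emptyset$ for all $j>0$. Suppose moreover that there exist a minimal monomial $x^\alpha\in B$ and a maximal monomial $x^\beta\in N$ such that $\min x^\alpha = 0$ and $\mathrm{e}^{-}_j(x^\alpha)\neq x^\beta$ for every admissible $\mathrm{e}^{-}_j$. Then for every $[y_0:y_1]\in\mathbb{P}^1$ the ideal $$\mathcal{I}=\left\langle \big(B\setminus\{x^\alpha\}\big)\cup\{y_0\,x^\alpha+y_1\,x^\beta\}\right\rangle\subset\mathbb{K}[x]$$ has Hilbert polynomial $\binom{n+t}{n}-d$.
   Context: $\mathbb{K}$ is an algebraically closed field of characteristic $0$, $\mathbb{K}[x]=\mathbb{K}[x_0,\ldots,x_n]$, and $x^\alpha=x_n^{\alpha_n}\cdots x_0^{\alpha_0}$. $\langle G\rangle$ is the ideal generated by $G$. The Hilbert polynomial of a homogeneous ideal $I$ is the polynomial equal to $\dim_{\mathbb{K}} I_t$ for $t\gg0$. $\mathcal{P}(n,d)$ is the set of monomials of degree $d$ in $\mathbb{K}[x]$. Elementary moves: $\mathrm{e}^{-}_i(x^\alpha)=\frac{x_{i-1}}{x_i}x^\alpha$, admissible on $x^\alpha$ when $0<i\le n$ and $x_i\mid x^\alpha$; $\mathrm{e}^{+}_j(x^\alpha)=\frac{x_{j+1}}{x_j}x^\alpha$, admissible on $x^\alpha$ when $0\le j<n$ and $x_j\mid x^\alpha$. A subset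 $B\subset\mathcal{P}(n,d)$ is a Borel set if for all $x^\alpha\in B$ one has $\mathrm{e}^{+}_j(x^\alpha)\in B$ for every admissible $\mathrm{e}^{+}_j$. $\min x^\alpha=\min\{j : x_j\mid x^\alpha\}$. For $j=0,\ldots,n-1$, $N_j=\{x^\alpha\in N : \min x^\alpha\ge j\}$. A monomial $x^\alpha$ is minimal in $B$ if $x^\alpha\in B$ and $\mathrm{e}^{-}_i(x^\alpha)\in N$ for all admissible $\mathrm{e}^{-}_i$; $x^\beta$ is maximal in $N$ if $x^\beta\in N$ and $\mathrm{e}^{+}_i(x^\beta)\in B$ for all admissible $\mathrm{e}^{+}_i$. *)

theory Defs
  imports
    "HOL-Library.Poly_Mapping"
    "HOL-Computational_Algebra.Polynomial"
    "HOL-Algebra.Ideal"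
begin

text \<open>
  A monomial is identified with its exponent vector, of type
  \<^typ>\<open>nat \<Rightarrow>\<^sub>0 nat\<close> (finitely supported maps), and polynomials are finitely
  supported maps from monomials to coefficients. The variables of this type are
  \<open>x\<^sub>0, x\<^sub>1, x\<^sub>2, \<dots>\<close>, so the ring in \<open>x\<^sub>0, \<dots>, x\<^sub>n\<close> is a subring, given as a
  ring record.
\<close>

type_synonym monomial = "nat \<Rightarrow>\<^sub>0 nat"
type_synonym 'a mpoly = "monomial \<Rightarrow>\<^sub>0 'a"

definition poly_ring :: "nat \<Rightarrow> 'a::comm_ring_1 mpoly ring" where
  "poly_ring n = \<lparr>carrier = {p. \<forall>m\<in>Poly_Mapping.keys p. Poly_Mapping.keys m \<subseteq> {..n}},
                  mult = (*), one = 1, zero = 0, add = (+)\<rparr>"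

definition scale :: "'a::comm_ring_1 \<Rightarrow> 'a mpoly \<Rightarrow> 'a mpoly" where
  "scale c p = Poly_Mapping.single 0 c * p"

definition monom_poly :: "monomial \<Rightarrow> 'a::comm_ring_1 mpoly" where
  "monom_poly m = Poly_Mapping.single m 1"

definition mdeg :: "monomial \<Rightarrow> nat" where
  "mdeg m = (\<Sum>i\<in>Poly_Mapping.keys m. Poly_Mapping.lookup m i)"


subsection \<open>Hilbert polynomials\<close>

definition graded_part :: "'a::comm_ring_1 mpoly set \<Rightarrow> nat \<Rightarrow> 'a mpoly set" where
  "graded_part I t = {p \<in> I. \<forall>m\<in>Poly_Mapping.keys p. mdeg m = t}"

text \<open>
  Following the convention for ideals, this concerns the dimension of \<open>I\<^sub>t\<close> itself,
  not that of the quotient by \<open>I\<^sub>t\<close>.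
\<close>

definition has_hilbert_poly :: "'a::field mpoly set \<Rightarrow> rat poly \<Rightarrow> bool" where
  "has_hilbert_poly I p \<longleftrightarrow>
     (\<forall>\<^sub>F t in sequentially.
        of_nat (vector_space.dim scale (graded_part I t)) = poly p (of_nat t))"

text \<open>\<open>(n + t choose n) = (t + 1) \<cdots> (t + n) / n!\<close> as a polynomial in \<open>t\<close>.\<close>

definition binom_poly :: "nat \<Rightarrow> rat poly" where
  "binom_poly n = Polynomial.smult (1 / fact n) (pochhammer [:1, 1:] n)"


subsection \<open>Borel sets\<close>

definition monomials :: "nat \<Rightarrow> nat \<Rightarrow> monomial set" where
  "monomials n d = {m. Poly_Mapping.keys m \<subseteq> {..n} \<and> mdeg m = d}"

text \<open>The moves are meaningful only where they are admissible.\<close>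

definition e_minus :: "nat \<Rightarrow> monomial \<Rightarrow> monomial" where
  "e_minus i m = m - Poly_Mapping.single i 1 + Poly_Mapping.single (i - 1) 1"

definition adm_minus :: "nat \<Rightarrow> nat \<Rightarrow> monomial \<Rightarrow> bool" where
  "adm_minus n i m \<longleftrightarrow> 0 < i \<and> i \<le> n \<and> i \<in> Poly_Mapping.keys m"

definition e_plus :: "nat \<Rightarrow> monomial \<Rightarrow> monomial" where
  "e_plus j m = m - Poly_Mapping.single j 1 + Poly_Mapping.single (j + 1) 1"

definition adm_plus :: "nat \<Rightarrow> nat \<Rightarrow> monomial \<Rightarrow> bool" where
  "adm_plus n j m \<longleftrightarrow> j < n \<and> j \<in> Poly_Mapping.keys m"

definition borel_set :: "nat \<Rightarrow> nat \<Rightarrow> monomial set \<Rightarrow> bool" where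
  "borel_set n d B \<longleftrightarrow>
     B \<subseteq> monomials n d \<and> (\<forall>m\<in>B. \<forall>j. adm_plus n j m \<longrightarrow> e_plus j m \<in> B)"

text \<open>Only used for monomials of positive degree: \<^const>\<open>Min\<close> of the empty set is unspecified.\<close>

definition min_var :: "monomial \<Rightarrow> nat" where
  "min_var m = Min (Poly_Mapping.keys m)"

definition min_var_ge :: "monomial set \<Rightarrow> nat \<Rightarrow> monomial set" where
  "min_var_ge N j = {m \<in> N. min_var m \<ge> j}"

definition minimal_in :: "nat \<Rightarrow> monomial set \<Rightarrow> monomial set \<Rightarrow> monomial \<Rightarrow> bool" where
  "minimal_in n B N m \<longleftrightarrow> m \<in> B \<and> (\<forall>i. adm_minus n i m \<longrightarrow> e_minus i m \<in> N)"

definition maximal_in :: "nat \<Rightarrow> monomial set \<Rightarrow> monomial set \<Rightarrow> monomial \<Rightarrow> bool" where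
  "maximal_in n B N m \<longleftrightarrow> m \<in> N \<and> (\<forall>i. adm_plus n i m \<longrightarrow> e_plus i m \<in> B)"


subsection \<open>Basic facts\<close>

lemma cring_poly_ring: "cring (poly_ring n :: 'a::comm_ring_1 mpoly ring)"
proof -
  let ?C = "{p :: 'a mpoly. \<forall>m\<in>Poly_Mapping.keys p. Poly_Mapping.keys m \<subseteq> {..n}}"
  have mult: "p * q \<in> ?C" if pq: "p \<in> ?C" "q \<in> ?C" for p q
  proof -
    have "Poly_Mapping.keys m \<subseteq> {..n}" if m: "m \<in> Poly_Mapping.keys (p * q)" for m
    proof -
      from m keys_mult[of p q] obtain a b where
        ab: "m = a + b" "a \<in> Poly_Mapping.keys p" "b \<in> Poly_Mapping.keys q" by blast
      have "Poly_Mapping.keys a \<subseteq> {..n}" "Poly_Mapping.keys b \<subseteq> {..n}"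
        using ab pq by blast+
      then show ?thesis
        using ab(1) Poly_Mapping.keys_add[of a b] by blast
    qed
    then show ?thesis by blast
  qed
  have add: "p + q \<in> ?C" if "p \<in> ?C" "q \<in> ?C" for p q
    using that Poly_Mapping.keys_add[of p q] by blast
  have neg: "- p \<in> ?C" if "p \<in> ?C" for p
    using that by (simp add: in_keys_iff)
  show ?thesis
  proof (rule cringI)
    show "abelian_group (poly_ring n :: 'a mpoly ring)"
    proof (rule abelian_groupI, goal_cases)
      case (1 p q) then show ?case using add[of p q] by (simp add: poly_ring_def)
    next
      case (6 p) then show ?case
        using neg[of p] by (intro bexI[of _ "- p"]) (simp_all add: poly_ring_def)
    qed (simp_all add: poly_ring_def add.assoc add.commute)
    show "Group.comm_monoid (poly_ring n :: 'a mpoly ring)"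
    proof (rule comm_monoidI, goal_cases)
      case (1 p q) then show ?case using mult[of p q] by (simp add: poly_ring_def)
    qed (simp_all add: poly_ring_def mult.assoc mult.commute)
  qed (simp add: poly_ring_def distrib_right)
qed

lemma vector_space_scale: "vector_space (scale :: 'a::field \<Rightarrow> 'a mpoly \<Rightarrow> 'a mpoly)"
proof (unfold_locales, goal_cases)
  case (1 a x y) then show ?case by (simp add: scale_def distrib_left)
next
  case (2 a b x) then show ?case by (simp add: scale_def single_add distrib_right)
next
  case (3 a b x) then show ?case by (simp add: scale_def mult_single flip: mult.assoc)
next
  case (4 x) then show ?case by (simp add: scale_def)
qed

lemma has_hilbert_poly_unique:
  assumes "has_hilbert_poly I p" "has_hilbert_poly I q"
  shows "p = q"
proof -
  have "\<forall>\<^sub>F t in sequentially. poly p (of_nat t) = poly q (of_nat t)"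
    using assms unfolding has_hilbert_poly_def by eventually_elim simp
  then obtain T where T: "\<And>t. t \<ge> T \<Longrightarrow> poly (p - q) (of_nat t) = 0"
    by (auto simp: eventually_sequentially)
  have "infinite ((of_nat :: nat \<Rightarrow> rat) ` {T..})"
    by (simp add: finite_image_iff inj_on_def infinite_Ici)
  moreover have "of_nat ` {T..} \<subseteq> {x. poly (p - q) x = 0}"
    using T by auto
  ultimately have "p - q = 0"
    using poly_roots_finite[of "p - q"] finite_subset by blast
  then show ?thesis by simp
qed

lemma poly_binom_poly: "poly (binom_poly n) (of_nat t) = of_nat ((n + t) choose n)"
proof -
  have *: "poly (pochhammer [:1, 1:] n) x = pochhammer (1 + x) n" for x :: rat
    by (simp add: pochhammer_prod poly_prod algebra_simps)
  show ?thesis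
    by (simp add: binom_poly_def * binomial_gbinomial gbinomial_pochhammer' add.commute)
qed

end

theory Submission
  imports Defs
begin

text \<open>
  Put \<open>C = B - {\<alpha>}\<close> and \<open>f = y\<^sub>0 x\<^sup>\<alpha> + y\<^sub>1 x\<^sup>\<beta>\<close>. As \<open>\<alpha>\<close> is minimal in \<open>B\<close>, the set \<open>C\<close> is
  again Borel (\<open>borel_set_minus_minimal\<close>). Its complement in degree \<open>d\<close> is \<open>N \<union> {\<alpha>}\<close>, which has
  \<open>d + 1\<close> elements. All of them are divisible by \<open>x\<^sub>0\<close>: the elements of \<open>N\<close> because \<open>N\<^sub>1\<close> is empty
  (for \<open>n = 1\<close> because \<open>B\<close>, being nonempty, contains \<open>x\<^sub>1\<^sup>d\<close>), and \<open>\<alpha>\<close> because its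
  least variable is \<open>x\<^sub>0\<close>. For such a Borel set the monomials of degree \<open>t \<ge> d\<close>
  outside the ideal \<open>\<langle>C\<rangle>\<close> are exactly the products of \<open>x\<^sub>0\<^sup>t\<^sup>-\<^sup>d\<close> with the monomials of degree \<open>d\<close>
  outside \<open>C\<close> (\<open>standard_monomials_borel\<close>), so \<open>\<langle>C\<rangle>\<close> has codimension \<open>d + 1\<close> in every degree
  \<open>t \<ge> d\<close>.

  Adding \<open>f\<close> to the generators lowers the codimension by exactly one. If \<open>m\<close> is \<open>\<alpha>\<close> or \<open>\<beta>\<close> and
  \<open>i > 0\<close>, then \<open>x\<^sub>i m = x\<^sub>0 (x\<^sub>i m / x\<^sub>0)\<close>, and \<open>x\<^sub>i m / x\<^sub>0\<close> is obtained from \<open>e\<^sup>+\<^sub>0 m\<close> by further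
  increasing moves. The monomial \<open>e\<^sup>+\<^sub>0 m\<close> lies in \<open>C\<close>: it lies in \<open>B\<close> because \<open>B\<close> is Borel (for
  \<open>m = \<alpha>\<close>) or \<open>\<beta>\<close> is maximal in \<open>N\<close> (for \<open>m = \<beta>\<close>), and \<open>e\<^sup>+\<^sub>0 \<beta> = \<alpha>\<close> would mean
  \<open>\<beta> = e\<^sup>-\<^sub>1 \<alpha>\<close>. Hence \<open>x\<^sub>i f \<in> \<langle>C\<rangle>\<close> for \<open>i > 0\<close>, and the only new element in degree \<open>t\<close>, up to
  \<open>\<langle>C\<rangle>\<close> and scalars, is \<open>x\<^sub>0\<^sup>t\<^sup>-\<^sup>d f\<close> (\<open>genideal_eq_span\<close>). It is not in \<open>\<langle>C\<rangle>\<close>, because \<open>f\<close> is nonzero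
  and supported on monomials outside \<open>C\<close>. The dimension in degree \<open>t\<close> is therefore
  \<open>(n + t choose n) - (d + 1) + 1\<close> (\<open>hilbert_poly_borel_plus_form\<close>), for all values of
  \<open>(y\<^sub>0, y\<^sub>1) \<noteq> (0, 0)\<close> alike.
\<close>

section \<open>Monomials\<close>

lemma mdeg_superset:
  assumes "finite S" "Poly_Mapping.keys m \<subseteq> S"
  shows "mdeg m = (\<Sum>i\<in>S. Poly_Mapping.lookup m i)"
  unfolding mdeg_def using assms by (intro sum.mono_neutral_left) (auto simp: in_keys_iff)

lemma mdeg_add: "mdeg (a + b) = mdeg a + mdeg b"
proof -
  let ?S = "Poly_Mapping.keys a \<union> Poly_Mapping.keys b"
  have "mdeg (a + b) = (\<Sum>i\<in>?S. Poly_Mapping.lookup (a + b) i)"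
    by (rule mdeg_superset) (simp_all add: Poly_Mapping.keys_add)
  also have "\<dots> = mdeg a + mdeg b"
    by (simp add: lookup_add sum.distrib flip: mdeg_superset)
  finally show ?thesis .
qed

lemma mdeg_single [simp]: "mdeg (Poly_Mapping.single i k) = k"
  by (simp add: mdeg_def)

lemma mdeg_eq_0_iff: "mdeg m = 0 \<longleftrightarrow> m = 0"
proof
  assume "mdeg m = 0"
  then have "\<forall>i\<in>Poly_Mapping.keys m. Poly_Mapping.lookup m i = 0"
    by (simp add: mdeg_def)
  then show "m = 0"
    using lookup_not_eq_zero_eq_in_keys[of m] by (intro poly_mapping_eqI) auto
qed (simp add: mdeg_def)

lemma keys_add_monomial:
  fixes a b :: monomial
  shows "Poly_Mapping.keys (a + b) = Poly_Mapping.keys a \<union> Poly_Mapping.keys b"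
  by (auto simp: in_keys_iff lookup_add)

lemma split_off_variable:
  fixes m :: monomial
  assumes "i \<in> Poly_Mapping.keys m"
  obtains m' where "m = Poly_Mapping.single i 1 + m'"
proof
  show "m = Poly_Mapping.single i 1 + (m - Poly_Mapping.single i 1)"
    using assms by (intro poly_mapping_eqI)
      (auto simp: lookup_add lookup_minus lookup_single in_keys_iff when_def)
qed

text \<open>Stars and bars: an exponent vector is the list of its \<open>n + 1\<close> entries.\<close>

lemma card_monomials: "card (monomials n t) = (n + t) choose n"
  and finite_monomials: "finite (monomials n t)"
proof -
  let ?L = "{l :: nat list. length l = Suc n \<and> sum_list l = t}"
  let ?f = "\<lambda>m :: monomial. map (Poly_Mapping.lookup m) [0..<Suc n]"
  have deg: "mdeg m = sum_list (?f m)" if "Poly_Mapping.keys m \<subseteq> {..n}" for m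
    using that
    by (subst mdeg_superset[of "{..n}"])
       (simp_all add: interv_sum_list_conv_sum_set_nat atLeast0LessThan lessThan_Suc_atMost
          del: upt_Suc)
  have "bij_betw ?f (monomials n t) ?L"
  proof (rule bij_betw_byWitness[where f' = Poly_Mapping.nth])
    show "\<forall>m\<in>monomials n t. Poly_Mapping.nth (?f m) = m"
      by (auto intro!: poly_mapping_eqI simp: monomials_def nth_default_def in_keys_iff subset_iff
          simp del: upt_Suc)
    show "\<forall>l\<in>?L. ?f (Poly_Mapping.nth l) = l"
      by (auto intro!: nth_equalityI simp: nth_default_def simp del: upt_Suc)
    show "?f ` monomials n t \<subseteq> ?L"
      using deg by (auto simp: monomials_def simp del: upt_Suc)
    show "Poly_Mapping.nth ` ?L \<subseteq> monomials n t"
    proof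
      fix m assume "m \<in> Poly_Mapping.nth ` ?L"
      then obtain l where l: "m = Poly_Mapping.nth l" "length l = Suc n" "sum_list l = t"
        by auto
      have "?f m = l"
        using l by (auto intro!: nth_equalityI simp: nth_default_def simp del: upt_Suc)
      moreover have "Poly_Mapping.keys m \<subseteq> {..n}"
      proof
        fix i assume "i \<in> Poly_Mapping.keys m"
        then have "nth_default 0 l i \<noteq> 0"
          by (simp only: in_keys_iff l(1) lookup_nth not_False_eq_True)
        then show "i \<in> {..n}"
          using l(2) by (simp add: nth_default_def split: if_splits)
      qed
      ultimately show "m \<in> monomials n t"
        using deg l by (simp add: monomials_def del: upt_Suc)
    qed
  qed
  then have "card (monomials n t) = card ?L"
    by (rule bij_betw_same_card)
  moreover have "card ?L = (n + t) choose n"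
    using card_length_sum_list[of "Suc n" t] binomial_symmetric[of n "n + t"]
    by (simp add: add.commute)
  ultimately show card: "card (monomials n t) = (n + t) choose n"
    by (rule trans)
  then show "finite (monomials n t)"
    by (intro card_ge_0_finite) simp
qed

section \<open>Monomial ideals generated by Borel sets\<close>

text \<open>
  Only the monomials of the ideal are recorded; its elements are the polynomials supported on them.
\<close>

definition monomial_ideal :: "nat \<Rightarrow> monomial set \<Rightarrow> monomial set" where
  "monomial_ideal n B = {w + b | w b. Poly_Mapping.keys w \<subseteq> {..n} \<and> b \<in> B}"

lemma monomial_ideal_closed:
  assumes "m \<in> monomial_ideal n B" "Poly_Mapping.keys u \<subseteq> {..n}"
  shows "u + m \<in> monomial_ideal n B"
proof -
  obtain w b where wb: "m = w + b" "Poly_Mapping.keys w \<subseteq> {..n}" "b \<in> B"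
    using assms(1) by (auto simp: monomial_ideal_def)
  have "u + m = (u + w) + b" "Poly_Mapping.keys (u + w) \<subseteq> {..n}"
    using wb assms(2) by (simp_all add: add.assoc keys_add_monomial)
  with wb(3) show ?thesis
    unfolding monomial_ideal_def by blast
qed

lemma keys_monomial_ideal:
  assumes "B \<subseteq> {m. Poly_Mapping.keys m \<subseteq> {..n}}" and "m \<in> monomial_ideal n B"
  shows "Poly_Mapping.keys m \<subseteq> {..n}"
proof -
  obtain w b where "m = w + b" "Poly_Mapping.keys w \<subseteq> {..n}" "b \<in> B"
    using assms(2) by (auto simp: monomial_ideal_def)
  then show ?thesis using assms(1) by (simp add: keys_add_monomial subset_iff)
qed

lemma e_plus_split:
  "e_plus j (Poly_Mapping.single j 1 + m) = Poly_Mapping.single (Suc j) 1 + m"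
  by (simp add: e_plus_def add.commute)

lemma e_minus_split:
  "e_minus (Suc j) (Poly_Mapping.single (Suc j) 1 + m) = Poly_Mapping.single j 1 + m"
  by (simp add: e_minus_def add.commute)

text \<open>
  The moves \<open>e\<^sup>+\<^sub>j, \<dots>, e\<^sup>+\<^sub>k\<^sub>-\<^sub>1\<close> act in turn on one factor, whose presence makes each of them admissible.
\<close>

lemma borel_raise:
  assumes B: "borel_set n d B"
    and j: "Poly_Mapping.single j 1 + m \<in> B" and "j \<le> k" and "k \<le> n"
  shows "Poly_Mapping.single k 1 + m \<in> B"
  using \<open>j \<le> k\<close> \<open>k \<le> n\<close>
proof (induction k rule: dec_induct)
  case base
  show ?case by (rule j)
next
  case (step i)
  then have "adm_plus n i (Poly_Mapping.single i 1 + m)"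
    by (simp add: adm_plus_def keys_add_monomial)
  then show ?case
    using B step e_plus_split[of i m] unfolding borel_set_def by (metis Suc_leD)
qed

text \<open>
  Raise the variables of a given element to \<open>x\<^sub>n\<close> one after another. The induction carries the
  power of \<open>x\<^sub>n\<close> collected so far, and runs over the degree of the rest.
\<close>

lemma borel_top_power:
  assumes B: "borel_set n d B" and "b \<in> B"
  shows "Poly_Mapping.single n d \<in> B"
proof -
  have "Poly_Mapping.single n (s + k) \<in> B"
    if "mdeg w = s" "Poly_Mapping.keys w \<subseteq> {..n}" "w + Poly_Mapping.single n k \<in> B" for w s k
    using that
  proof (induction s arbitrary: w k)
    case 0
    then show ?case by (simp add: mdeg_eq_0_iff)
  next
    case (Suc s)
    then have "w \<noteq> 0" by (auto simp: mdeg_def)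
    then obtain j where j: "j \<in> Poly_Mapping.keys w"
      by (metis ex_in_conv keys_eq_empty)
    then obtain w' where w': "w = Poly_Mapping.single j 1 + w'"
      by (rule split_off_variable)
    have "Poly_Mapping.single n 1 + (w' + Poly_Mapping.single n k) \<in> B"
    proof (rule borel_raise[OF B])
      show "Poly_Mapping.single j 1 + (w' + Poly_Mapping.single n k) \<in> B"
        using Suc.prems(3) w' by (simp add: add.assoc)
      show "j \<le> n" using Suc.prems(2) j by auto
    qed simp
    moreover have "Poly_Mapping.single n 1 + (w' + Poly_Mapping.single n k) =
        w' + Poly_Mapping.single n (Suc k)"
      using single_add[of n 1 k] by (simp add: add.left_commute)
    ultimately have "w' + Poly_Mapping.single n (Suc k) \<in> B" by simp
    then show ?case
      using Suc.IH[of w' "Suc k"] Suc.prems w' by (simp add: mdeg_add keys_add_monomial)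
  qed
  from this[of b d 0] show ?thesis
    using B \<open>b \<in> B\<close> by (auto simp: borel_set_def monomials_def)
qed

text \<open>
  If \<open>b\<close> divides \<open>x\<^sub>0\<^sup>s m\<close> with
  cofactor \<open>w\<close>, a common factor \<open>x\<^sub>0\<close> can be removed from \<open>w\<close>; when \<open>x\<^sub>0\<close> does not divide \<open>w\<close> it
  divides \<open>b\<close>, and exchanging it there for a variable of \<open>w\<close> keeps \<open>b\<close> in \<open>B\<close> and puts an \<open>x\<^sub>0\<close> into the
  cofactor. After \<open>s\<close> rounds the degrees force \<open>w = 1\<close> and \<open>m = b\<close>.
\<close>

lemma borel_cancel_x0:
  assumes B: "borel_set n d B"
    and "b \<in> B" "Poly_Mapping.keys w \<subseteq> {..n}"
    and "w + b = Poly_Mapping.single 0 s + m" "mdeg m = d"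
  shows "m \<in> B"
  using assms(2-)
proof (induction s arbitrary: w b)
  case 0
  then have "mdeg w = 0"
    using B mdeg_add[of w b] by (auto simp: borel_set_def monomials_def)
  then show ?case
    using 0 by (simp add: mdeg_eq_0_iff)
next
  case (Suc s)
  have bd: "mdeg b = d"
    using B Suc.prems(1) by (auto simp: borel_set_def monomials_def)
  have unit: "Poly_Mapping.single 0 (Suc s) =
      Poly_Mapping.single 0 1 + (Poly_Mapping.single 0 s :: monomial)"
    by (simp flip: single_add)
  have "mdeg w = Suc s"
    using arg_cong[OF Suc.prems(3), of mdeg] bd Suc.prems(4) by (simp add: mdeg_add)
  then have "w \<noteq> 0" by (auto simp: mdeg_def)
  show ?case
  proof (cases "0 \<in> Poly_Mapping.keys w")
    case True
    then obtain w' where w': "w = Poly_Mapping.single 0 1 + w'"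
      by (rule split_off_variable)
    then have "w' + b = Poly_Mapping.single 0 s + m"
      using Suc.prems(3) unit by (simp add: add.assoc)
    then show ?thesis
      using Suc.IH[of b w'] Suc.prems w' by (simp add: keys_add_monomial)
  next
    case False
    obtain k where k: "k \<in> Poly_Mapping.keys w"
      using \<open>w \<noteq> 0\<close> by (metis ex_in_conv keys_eq_empty)
    then obtain w' where w': "w = Poly_Mapping.single k 1 + w'"
      by (rule split_off_variable)
    have "0 \<in> Poly_Mapping.keys (w + b)"
      unfolding Suc.prems(3) by (simp add: keys_add_monomial)
    then have "0 \<in> Poly_Mapping.keys b"
      using False by (simp add: keys_add_monomial)
    then obtain b' where b': "b = Poly_Mapping.single 0 1 + b'"
      by (rule split_off_variable)
    \<comment> \<open>Exchange the factor \<open>x\<^sub>k\<close> of the cofactor for the factor \<open>x\<^sub>0\<close> of \<open>b\<close>.\<close>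
    have "Poly_Mapping.single k 1 + b' \<in> B"
      using borel_raise[OF B, of 0 b' k] Suc.prems(1,2) b' k by auto
    moreover have "w' + (Poly_Mapping.single k 1 + b') = Poly_Mapping.single 0 s + m"
    proof -
      have "Poly_Mapping.single 0 1 + (w' + (Poly_Mapping.single k 1 + b')) =
            Poly_Mapping.single 0 1 + (Poly_Mapping.single 0 s + m)"
        using Suc.prems(3) unit w' b' by (simp add: ac_simps)
      then show ?thesis by simp
    qed
    ultimately show ?thesis
      using Suc.IH[of "Poly_Mapping.single k 1 + b'" w'] Suc.prems w'
      by (simp add: keys_add_monomial)
  qed
qed

text \<open>
  Multiplication by \<open>x\<^sub>0\<close> keeps a monomial outside the ideal by \<open>borel_cancel_x0\<close>. Conversely,
  any monomial outside the ideal can be divided by a variable without entering the ideal, and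
  in degree above \<open>d\<close> that variable can be chosen to be \<open>x\<^sub>0\<close>.
\<close>

lemma standard_monomials_borel:
  assumes B: "borel_set n d B" and "d > 0"
    and x0: "\<And>m. m \<in> monomials n d - B \<Longrightarrow> 0 \<in> Poly_Mapping.keys m"
  shows "monomials n (s + d) - monomial_ideal n B =
           (+) (Poly_Mapping.single 0 s) ` (monomials n d - B)"
proof (intro equalityI subsetI)
  fix m assume "m \<in> (+) (Poly_Mapping.single 0 s) ` (monomials n d - B)"
  then obtain m' where m': "m = Poly_Mapping.single 0 s + m'" "m' \<in> monomials n d" "m' \<notin> B"
    by auto
  then have "m \<in> monomials n (s + d)"
    by (auto simp: monomials_def mdeg_add keys_add_monomial)
  moreover have "m \<notin> monomial_ideal n B"
  proof
    assume "m \<in> monomial_ideal n B"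
    then obtain w b where "m = w + b" "Poly_Mapping.keys w \<subseteq> {..n}" "b \<in> B"
      by (auto simp: monomial_ideal_def)
    then have "m' \<in> B"
      using borel_cancel_x0[OF B, of b w s m'] m' by (simp add: monomials_def)
    with m'(3) show False by contradiction
  qed
  ultimately show "m \<in> monomials n (s + d) - monomial_ideal n B" by blast
next
  fix m assume "m \<in> monomials n (s + d) - monomial_ideal n B"
  then show "m \<in> (+) (Poly_Mapping.single 0 s) ` (monomials n d - B)"
  proof (induction s arbitrary: m)
    case 0
    have "0 + b \<in> monomial_ideal n B" if "b \<in> B" for b
      using that unfolding monomial_ideal_def by fastforce
    then show ?case using 0 by auto
  next
    case (Suc s)
    have divide: "m' \<in> (+) (Poly_Mapping.single 0 s) ` (monomials n d - B)"
      if "m = Poly_Mapping.single k 1 + m'" for k m'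
      using Suc that monomial_ideal_closed[of m' n B "Poly_Mapping.single k 1"]
      by (auto simp: monomials_def mdeg_add keys_add_monomial)
    have "m \<noteq> 0" using Suc.prems by (auto simp: monomials_def mdeg_def)
    then obtain k where "k \<in> Poly_Mapping.keys m"
      by (metis ex_in_conv keys_eq_empty)
    then obtain m' where "m = Poly_Mapping.single k 1 + m'"
      by (rule split_off_variable)
    \<comment> \<open>Whatever variable is divided out, \<open>x\<^sub>0\<close> divides the quotient, so it divides \<open>m\<close>.\<close>
    then have "0 \<in> Poly_Mapping.keys m"
      using divide[of k m'] x0 by (auto simp: keys_add_monomial)
    then obtain m'' where m'': "m = Poly_Mapping.single 0 1 + m''"
      by (rule split_off_variable)
    then obtain v where v: "v \<in> monomials n d - B" "m'' = Poly_Mapping.single 0 s + v"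
      using divide[of 0 m''] by auto
    have "m = Poly_Mapping.single 0 (Suc s) + v"
      using m'' v by (simp flip: single_add add.assoc)
    with v show ?case by blast
  qed
qed

lemma card_monomial_ideal_borel:
  assumes B: "borel_set n d B" and "d > 0"
    and x0: "\<And>m. m \<in> monomials n d - B \<Longrightarrow> 0 \<in> Poly_Mapping.keys m"
  shows "card (monomial_ideal n B \<inter> monomials n (s + d)) + card (monomials n d - B) =
           (n + (s + d)) choose n"
proof -
  have "card (monomials n (s + d) - monomial_ideal n B) = card (monomials n d - B)"
    using arg_cong[OF standard_monomials_borel[OF assms, of s], of card]
    by (simp only:) (rule card_image, simp add: inj_on_def)
  then show ?thesis
    using card_Int_Diff[OF finite_monomials, of n "s + d" "monomial_ideal n B"]
    by (simp add: card_monomials Int_commute)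
qed

text \<open>
  A move \<open>e\<^sup>+\<^sub>j m = \<alpha>\<close> that left the smaller set would be undone by \<open>e\<^sup>-\<close>, so minimality of \<open>\<alpha>\<close>
  would put \<open>m\<close> into \<open>N\<close>.
\<close>

lemma borel_set_minus_minimal:
  assumes B: "borel_set n d B" and "minimal_in n B N \<alpha>" and "N \<inter> B = {}"
  shows "borel_set n d (B - {\<alpha>})"
  unfolding borel_set_def
proof (intro conjI ballI allI impI)
  show "B - {\<alpha>} \<subseteq> monomials n d" using B by (auto simp: borel_set_def)
next
  fix m j assume m: "m \<in> B - {\<alpha>}" "adm_plus n j m"
  then obtain m' where m': "m = Poly_Mapping.single j 1 + m'"
    by (metis adm_plus_def split_off_variable)
  have "e_plus j m \<noteq> \<alpha>"
  proof
    assume "e_plus j m = \<alpha>"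
    then have \<alpha>: "\<alpha> = Poly_Mapping.single (Suc j) 1 + m'"
      using m' e_plus_split by simp
    then have "adm_minus n (Suc j) \<alpha>"
      using m(2) by (simp add: adm_minus_def adm_plus_def keys_add_monomial)
    then have "m \<in> N"
      using assms(2) \<alpha> m' e_minus_split[of j m'] by (auto simp: minimal_in_def)
    then show False using m assms(3) by blast
  qed
  then show "e_plus j m \<in> B - {\<alpha>}"
    using B m by (auto simp: borel_set_def)
qed

section \<open>Spans of monomials and homogeneous elements\<close>

interpretation mpoly: vector_space "scale :: 'a::field \<Rightarrow> 'a mpoly \<Rightarrow> 'a mpoly"
  by (rule vector_space_scale)

lemma lookup_scale: "Poly_Mapping.lookup (scale c p) m = c * Poly_Mapping.lookup p m"
  by (simp add: scale_def Poly_Mapping.map.rep_eq when_def flip: mult_map_scale_conv_mult)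

lemma mpoly_eq_sum:
  fixes p :: "'a::field mpoly"
  shows "p = (\<Sum>m\<in>Poly_Mapping.keys p. scale (Poly_Mapping.lookup p m) (monom_poly m))"
  by (rule poly_mapping_eqI)
     (simp add: lookup_sum lookup_scale monom_poly_def lookup_single when_def in_keys_iff
       if_distrib[of "(*) _"] sum.delta cong: if_cong)

lemma monom_poly_mult: "monom_poly a * monom_poly b = monom_poly (a + b)"
  by (simp add: monom_poly_def mult_single)

lemma scale_mult_right: "p * scale c q = scale c (p * q)"
  by (simp add: scale_def mult.left_commute)

lemma lookup_monom_poly_mult:
  fixes p :: "'a::field mpoly"
  shows "Poly_Mapping.lookup (monom_poly u * p) (u + m) = Poly_Mapping.lookup p m"
proof -
  have "monom_poly u * p =
        (\<Sum>k\<in>Poly_Mapping.keys p. scale (Poly_Mapping.lookup p k) (monom_poly (u + k)))"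
    by (subst mpoly_eq_sum[of p]) (simp add: sum_distrib_left scale_mult_right monom_poly_mult)
  then show ?thesis
    by (simp add: lookup_sum lookup_scale monom_poly_def lookup_single when_def in_keys_iff
       if_distrib[of "(*) _"] sum.delta cong: if_cong)
qed

lemma keys_monom_poly_mult:
  fixes p :: "'a::field mpoly"
  shows "Poly_Mapping.keys (monom_poly u * p) = (+) u ` Poly_Mapping.keys p"
proof
  show "Poly_Mapping.keys (monom_poly u * p) \<subseteq> (+) u ` Poly_Mapping.keys p"
    using keys_mult[of "monom_poly u" p] by (auto simp: monom_poly_def)
  show "(+) u ` Poly_Mapping.keys p \<subseteq> Poly_Mapping.keys (monom_poly u * p)"
    by (auto simp: in_keys_iff lookup_monom_poly_mult)
qed

lemma span_monom_polys:
  "mpoly.span (monom_poly ` A) = {p :: 'a::field mpoly. Poly_Mapping.keys p \<subseteq> A}"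
proof (rule mpoly.span_subspace)
  show "monom_poly ` A \<subseteq> {p :: 'a mpoly. Poly_Mapping.keys p \<subseteq> A}"
    by (auto simp: monom_poly_def)
  show "{p :: 'a mpoly. Poly_Mapping.keys p \<subseteq> A} \<subseteq> mpoly.span (monom_poly ` A)"
  proof safe
    fix p :: "'a mpoly" assume "Poly_Mapping.keys p \<subseteq> A"
    then have "(\<Sum>m\<in>Poly_Mapping.keys p. scale (Poly_Mapping.lookup p m) (monom_poly m))
                 \<in> mpoly.span (monom_poly ` A)"
      by (intro mpoly.span_sum mpoly.span_scale mpoly.span_base) auto
    then show "p \<in> mpoly.span (monom_poly ` A)"
      by (simp only: mpoly_eq_sum[of p, symmetric])
  qed
  show "mpoly.subspace {p :: 'a mpoly. Poly_Mapping.keys p \<subseteq> A}"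
  proof (rule mpoly.subspaceI)
    show "x + y \<in> {p. Poly_Mapping.keys p \<subseteq> A}"
      if "x \<in> {p. Poly_Mapping.keys p \<subseteq> A}" "y \<in> {p. Poly_Mapping.keys p \<subseteq> A}"
      for x y :: "'a mpoly"
      using that Poly_Mapping.keys_add[of x y] by blast
  qed (auto simp: in_keys_iff lookup_scale)
qed

lemma inj_monom_poly: "inj (monom_poly :: monomial \<Rightarrow> 'a::field mpoly)"
proof (rule injI)
  fix a b :: monomial
  assume "monom_poly a = (monom_poly b :: 'a mpoly)"
  then have "Poly_Mapping.keys (monom_poly a :: 'a mpoly) = Poly_Mapping.keys (monom_poly b :: 'a mpoly)"
    by simp
  then show "a = b" by (simp add: monom_poly_def)
qed

lemma independent_monom_polys:
  "mpoly.independent (monom_poly ` A :: 'a::field mpoly set)"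
proof
  assume "mpoly.dependent (monom_poly ` A :: 'a mpoly set)"
  then obtain m where m: "m \<in> A"
    "(monom_poly m :: 'a mpoly) \<in> mpoly.span (monom_poly ` A - {monom_poly m})"
    unfolding mpoly.dependent_def by blast
  have "monom_poly ` A - {monom_poly m} = (monom_poly ` (A - {m}) :: 'a mpoly set)"
    using inj_monom_poly by (auto dest: injD)
  with m have "(monom_poly m :: 'a mpoly) \<in> mpoly.span (monom_poly ` (A - {m}))"
    by simp
  then show False
    unfolding span_monom_polys by (simp add: monom_poly_def)
qed

definition homogeneous_part :: "nat \<Rightarrow> 'a::field mpoly \<Rightarrow> 'a mpoly" where
  "homogeneous_part t = Poly_Mapping.mapp (\<lambda>m c. c when mdeg m = t)"

lemma lookup_homogeneous_part:
  "Poly_Mapping.lookup (homogeneous_part t p) m = (Poly_Mapping.lookup p m when mdeg m = t)"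
  by (simp add: homogeneous_part_def lookup_mapp when_def in_keys_iff)

text \<open>
  The projection to degree \<open>t\<close> is linear and sends each homogeneous generator to itself or to \<open>0\<close>.
\<close>

lemma graded_part_span:
  fixes E :: "'a::field mpoly set"
  assumes hom: "\<And>e. e \<in> E \<Longrightarrow> \<exists>t. \<forall>m\<in>Poly_Mapping.keys e. mdeg m = t"
  shows "graded_part (mpoly.span E) t = mpoly.span (graded_part E t)"
proof
  have proj: "homogeneous_part t p \<in> mpoly.span (graded_part E t)" if "p \<in> mpoly.span E" for p
    using that
  proof (induction rule: mpoly.span_induct_alt)
    case base
    have "homogeneous_part t 0 = (0 :: 'a mpoly)"
      by (rule poly_mapping_eqI) (simp add: lookup_homogeneous_part)
    then show ?case by (simp add: mpoly.span_zero)
  next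
    case (step c x y)
    have split: "homogeneous_part t (scale c x + y) =
        scale c (homogeneous_part t x) + homogeneous_part t y"
      by (rule poly_mapping_eqI)
         (simp add: lookup_homogeneous_part lookup_add lookup_scale when_def)
    have "homogeneous_part t x \<in> mpoly.span (graded_part E t)"
    proof (cases "\<forall>m\<in>Poly_Mapping.keys x. mdeg m = t")
      case True
      then have "homogeneous_part t x = x"
        by (intro poly_mapping_eqI) (auto simp: lookup_homogeneous_part when_def in_keys_iff)
      then show ?thesis
        using True step(1) by (auto intro: mpoly.span_base simp: graded_part_def)
    next
      case False
      then have "\<forall>m\<in>Poly_Mapping.keys x. mdeg m \<noteq> t"
        using hom[OF step(1)] by metis
      then have "homogeneous_part t x = 0"
        by (intro poly_mapping_eqI) (auto simp: lookup_homogeneous_part when_def in_keys_iff)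
      then show ?thesis by (simp add: mpoly.span_zero)
    qed
    then show ?case
      unfolding split using step(2) by (intro mpoly.span_add mpoly.span_scale)
  qed
  show "graded_part (mpoly.span E) t \<subseteq> mpoly.span (graded_part E t)"
  proof
    fix p assume "p \<in> graded_part (mpoly.span E) t"
    then have p: "p \<in> mpoly.span E" "\<forall>m\<in>Poly_Mapping.keys p. mdeg m = t"
      by (simp_all add: graded_part_def)
    then have "homogeneous_part t p = p"
      by (intro poly_mapping_eqI) (auto simp: lookup_homogeneous_part when_def in_keys_iff)
    then show "p \<in> mpoly.span (graded_part E t)"
      using proj[OF p(1)] by simp
  qed
next
  have "mpoly.subspace {p :: 'a mpoly. \<forall>m\<in>Poly_Mapping.keys p. mdeg m = t}"
    using mpoly.subspace_span[of "monom_poly ` {m. mdeg m = t} :: 'a mpoly set"]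
    by (simp add: span_monom_polys subset_iff Ball_def)
  then have "mpoly.subspace (mpoly.span E \<inter> {p. \<forall>m\<in>Poly_Mapping.keys p. mdeg m = t})"
    by (intro mpoly.subspace_inter mpoly.subspace_span)
  moreover have "graded_part E t \<subseteq> mpoly.span E \<inter> {p. \<forall>m\<in>Poly_Mapping.keys p. mdeg m = t}"
    by (auto simp: graded_part_def intro: mpoly.span_base)
  ultimately have "mpoly.span (graded_part E t)
      \<subseteq> mpoly.span E \<inter> {p. \<forall>m\<in>Poly_Mapping.keys p. mdeg m = t}"
    by (rule mpoly.span_minimal[rotated])
  then show "mpoly.span (graded_part E t) \<subseteq> graded_part (mpoly.span E) t"
    by (auto simp: graded_part_def)
qed

section \<open>A Borel ideal enlarged by one form\<close>

lemma carrier_poly_ring_eq_span: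
  "carrier (poly_ring n) =
     mpoly.span (monom_poly ` {m. Poly_Mapping.keys m \<subseteq> {..n}} :: 'a::field mpoly set)"
  by (auto simp: span_monom_polys poly_ring_def)

lemma subspace_of_ideal:
  fixes I :: "'a::field mpoly set"
  assumes "ideal I (poly_ring n)"
  shows "mpoly.subspace I"
proof -
  interpret ideal I "poly_ring n" by (rule assms)
  have "Poly_Mapping.single 0 c \<in> carrier (poly_ring n)" for c :: 'a
    by (simp add: poly_ring_def)
  then show ?thesis
    using additive_subgroup.zero_closed[OF additive_subgroup_axioms]
      additive_subgroup.a_closed[OF additive_subgroup_axioms] I_l_closed
    by (intro mpoly.subspaceI) (simp_all add: poly_ring_def scale_def)
qed

text \<open>
  By bilinearity, closure under multiplication need only be tested for monomials times elements
  of the spanning set.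
\<close>

lemma ideal_span:
  fixes E :: "'a::field mpoly set"
  assumes "E \<subseteq> carrier (poly_ring n)"
    and mult: "\<And>u e. Poly_Mapping.keys u \<subseteq> {..n} \<Longrightarrow> e \<in> E \<Longrightarrow>
                 monom_poly u * e \<in> mpoly.span E"
  shows "ideal (mpoly.span E) (poly_ring n)"
proof -
  interpret R: cring "poly_ring n :: 'a mpoly ring" by (rule cring_poly_ring)
  have carrier: "mpoly.span E \<subseteq> carrier (poly_ring n)"
    using assms(1) unfolding carrier_poly_ring_eq_span
    by (intro mpoly.span_minimal mpoly.subspace_span)
  have monom: "monom_poly u * p \<in> mpoly.span E"
    if "p \<in> mpoly.span E" "Poly_Mapping.keys u \<subseteq> {..n}" for u p
    using that(1)
  proof (induction rule: mpoly.span_induct_alt)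
    case base
    show ?case by (simp add: mpoly.span_zero)
  next
    case (step c x y)
    have "scale c (monom_poly u * x) + monom_poly u * y \<in> mpoly.span E"
      using step mult[OF that(2)] by (intro mpoly.span_add mpoly.span_scale)
    then show ?case by (simp add: distrib_left scale_mult_right)
  qed
  have absorb: "q * p \<in> mpoly.span E"
    if "p \<in> mpoly.span E" "q \<in> carrier (poly_ring n)" for p q
  proof -
    have "q * p = (\<Sum>m\<in>Poly_Mapping.keys q.
                     scale (Poly_Mapping.lookup q m) (monom_poly m * p))"
      by (subst mpoly_eq_sum[of q]) (simp add: sum_distrib_right scale_def mult.assoc)
    moreover have "\<dots> \<in> mpoly.span E"
      using that by (intro mpoly.span_sum mpoly.span_scale monom) (auto simp: poly_ring_def)
    ultimately show ?thesis by (simp only:)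
  qed
  show ?thesis
  proof (rule idealI)
    show "ring (poly_ring n :: 'a mpoly ring)" by (rule R.ring_axioms)
    show "subgroup (mpoly.span E) (add_monoid (poly_ring n))"
    proof (rule R.add.subgroupI)
      show "mpoly.span E \<subseteq> carrier (poly_ring n)" by (rule carrier)
      show "mpoly.span E \<noteq> {}" using mpoly.span_zero by blast
      fix p assume p: "p \<in> mpoly.span E"
      then have neg: "- p \<in> mpoly.span E" by (rule mpoly.span_neg)
      have "\<ominus>\<^bsub>poly_ring n\<^esub> p = - p"
        using p neg carrier by (intro R.minus_equality) (auto simp: poly_ring_def)
      with neg show "\<ominus>\<^bsub>poly_ring n\<^esub> p \<in> mpoly.span E" by simp
    next
      fix p q assume "p \<in> mpoly.span E" "q \<in> mpoly.span E"
      then show "p \<oplus>\<^bsub>poly_ring n\<^esub> q \<in> mpoly.span E"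
        using mpoly.span_add by (simp add: poly_ring_def)
    qed
    show "q \<otimes>\<^bsub>poly_ring n\<^esub> p \<in> mpoly.span E" "p \<otimes>\<^bsub>poly_ring n\<^esub> q \<in> mpoly.span E"
      if "p \<in> mpoly.span E" "q \<in> carrier (poly_ring n)" for p q
      using absorb[OF that] by (simp_all add: poly_ring_def mult.commute)
  qed
qed

text \<open>
  The span on the right is an ideal because a monomial multiple of a power of \<open>x\<^sub>0\<close> times \<open>f\<close> either
  uses \<open>x\<^sub>0\<close> alone, and is again of this form, or uses some \<open>x\<^sub>i\<close> with \<open>i > 0\<close>, and then all its
  monomials lie in the monomial ideal.
\<close>

lemma genideal_eq_span:
  fixes f :: "'a::field mpoly"
  assumes C: "C \<subseteq> {m. Poly_Mapping.keys m \<subseteq> {..n}}"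
    and f: "f \<in> carrier (poly_ring n)"
    and absorb: "\<And>i m. 0 < i \<Longrightarrow> i \<le> n \<Longrightarrow> m \<in> Poly_Mapping.keys f \<Longrightarrow>
                   Poly_Mapping.single i 1 + m \<in> monomial_ideal n C"
  shows "Idl\<^bsub>poly_ring n\<^esub> (monom_poly ` C \<union> {f}) =
    mpoly.span (monom_poly ` monomial_ideal n C \<union>
      range (\<lambda>s. monom_poly (Poly_Mapping.single 0 s) * f))"
    (is "?I = mpoly.span ?E")
proof
  interpret R: cring "poly_ring n :: 'a mpoly ring" by (rule cring_poly_ring)
  have monom_carrier: "monom_poly u \<in> carrier (poly_ring n :: 'a mpoly ring)"
    if "Poly_Mapping.keys u \<subseteq> {..n}" for u
    using that by (simp add: poly_ring_def monom_poly_def)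
  have mult_carrier: "p * q \<in> carrier (poly_ring n)"
    if "p \<in> carrier (poly_ring n)" "q \<in> carrier (poly_ring n)" for p q :: "'a mpoly"
    using R.m_closed[OF that] by (simp add: poly_ring_def)
  have gens: "monom_poly ` C \<union> {f} \<subseteq> carrier (poly_ring n)"
    using C f monom_carrier by auto
  have C_sub: "C \<subseteq> monomial_ideal n C"
  proof
    fix b assume "b \<in> C"
    then have "b = 0 + b \<and> Poly_Mapping.keys (0 :: monomial) \<subseteq> {..n} \<and> b \<in> C" by simp
    then show "b \<in> monomial_ideal n C" unfolding monomial_ideal_def by blast
  qed
  note MI = keys_monomial_ideal[OF C]
  have E_carrier: "?E \<subseteq> carrier (poly_ring n)"
    using MI f by (auto intro!: monom_carrier mult_carrier split: if_splits)
  show "?I \<subseteq> mpoly.span ?E"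
  proof (rule R.genideal_minimal)
    show "ideal (mpoly.span ?E) (poly_ring n)"
    proof (rule ideal_span[OF E_carrier])
      fix u :: monomial and e :: "'a mpoly"
      assume u: "Poly_Mapping.keys u \<subseteq> {..n}" and "e \<in> ?E"
      then consider m where "e = monom_poly m" "m \<in> monomial_ideal n C"
        | s where "e = monom_poly (Poly_Mapping.single 0 s) * f" by blast
      then show "monom_poly u * e \<in> mpoly.span ?E"
      proof cases
        case 1
        then have "monom_poly u * e = monom_poly (u + m)" "u + m \<in> monomial_ideal n C"
          using monomial_ideal_closed u by (simp_all add: monom_poly_mult)
        then show ?thesis by (auto intro: mpoly.span_base)
      next
        case 2
        show ?thesis
        proof (cases "Poly_Mapping.keys u \<subseteq> {0}")
          case True
          then have "u = Poly_Mapping.single 0 (Poly_Mapping.lookup u 0)"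
            by (intro poly_mapping_eqI) (auto simp: lookup_single when_def in_keys_iff)
          then obtain k where "u = Poly_Mapping.single 0 k" by blast
          then have "monom_poly u * e = monom_poly (Poly_Mapping.single 0 (k + s)) * f"
            using 2 by (simp add: monom_poly_mult single_add flip: mult.assoc)
          then show ?thesis by (auto intro: mpoly.span_base)
        next
          case False
          then obtain i where i: "i \<in> Poly_Mapping.keys u" "i > 0" by fastforce
          then obtain u' where u': "u = Poly_Mapping.single i 1 + u'"
            using split_off_variable by blast
          let ?v = "u' + Poly_Mapping.single 0 s"
          have v: "Poly_Mapping.keys ?v \<subseteq> {..n}"
            using u u' by (simp add: keys_add_monomial)
          have "monom_poly u * e = monom_poly (u + Poly_Mapping.single 0 s) * f"
            using 2 by (simp add: monom_poly_mult flip: mult.assoc)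
          moreover have "(u + Poly_Mapping.single 0 s) + m \<in> monomial_ideal n C"
            if "m \<in> Poly_Mapping.keys f" for m
          proof -
            have "?v + (Poly_Mapping.single i 1 + m) \<in> monomial_ideal n C"
              using absorb[of i m] monomial_ideal_closed[OF _ v] i u that by blast
            then show ?thesis using u' by (simp add: ac_simps)
          qed
          ultimately have "Poly_Mapping.keys (monom_poly u * e) \<subseteq> monomial_ideal n C"
            by (auto simp: keys_monom_poly_mult)
          then have "monom_poly u * e \<in> mpoly.span (monom_poly ` monomial_ideal n C)"
            by (simp add: span_monom_polys)
          then show ?thesis
            using mpoly.span_mono[of "monom_poly ` monomial_ideal n C" ?E] by blast
        qed
      qed
    qed
    have "f \<in> ?E"
      by (rule UnI2, rule range_eqI[of _ _ 0]) (simp add: monom_poly_def)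
    then show "monom_poly ` C \<union> {f} \<subseteq> mpoly.span ?E"
      using C_sub by (auto intro: mpoly.span_base)
  qed
  interpret I: ideal ?I "poly_ring n" by (rule R.genideal_ideal[OF gens])
  have mult: "q * p \<in> ?I" if "p \<in> ?I" "q \<in> carrier (poly_ring n)" for p q
    using I.I_l_closed[OF that] by (simp add: poly_ring_def)
  have self: "monom_poly ` C \<union> {f} \<subseteq> ?I" by (rule R.genideal_self[OF gens])
  have "?E \<subseteq> ?I"
  proof
    fix e assume "e \<in> ?E"
    then consider w b where "e = monom_poly w * monom_poly b" "Poly_Mapping.keys w \<subseteq> {..n}" "b \<in> C"
      | s where "e = monom_poly (Poly_Mapping.single 0 s) * f"
      by (auto simp: monomial_ideal_def monom_poly_mult)
    then show "e \<in> ?I"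
    proof cases
      case (1 w b)
      then show ?thesis using self mult[OF _ monom_carrier, of "monom_poly b" w] by blast
    next
      case (2 s)
      have "Poly_Mapping.keys (Poly_Mapping.single 0 s :: monomial) \<subseteq> {..n}" by simp
      then show ?thesis using 2 self mult[OF _ monom_carrier] by blast
    qed
  qed
  then show "mpoly.span ?E \<subseteq> ?I"
    by (intro mpoly.span_minimal subspace_of_ideal[OF I.ideal_axioms])
qed

text \<open>
  In degree \<open>t = s + d\<close> the ideal has as basis the monomials of the ideal generated by \<open>C\<close> together
  with \<open>x\<^sub>0\<^sup>s f\<close>. The latter is independent of the former because each of its monomials is \<open>x\<^sub>0\<^sup>s\<close>
  times a monomial of degree \<open>d\<close> outside \<open>C\<close>, hence outside the monomial ideal.
\<close>

lemma hilbert_poly_borel_plus_form: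
  fixes f :: "'a::field mpoly"
  assumes C: "borel_set n d C" and "d > 0"
    and x0: "\<And>m. m \<in> monomials n d - C \<Longrightarrow> 0 \<in> Poly_Mapping.keys m"
    and "f \<noteq> 0" and f: "Poly_Mapping.keys f \<subseteq> monomials n d - C"
    and absorb: "\<And>i m. 0 < i \<Longrightarrow> i \<le> n \<Longrightarrow> m \<in> Poly_Mapping.keys f \<Longrightarrow>
                   Poly_Mapping.single i 1 + m \<in> monomial_ideal n C"
  shows "has_hilbert_poly (Idl\<^bsub>poly_ring n\<^esub> (monom_poly ` C \<union> {f}))
           (binom_poly n + 1 - [:of_nat (card (monomials n d - C)):])"
proof -
  let ?MI = "monomial_ideal n C"
  let ?g = "\<lambda>s. monom_poly (Poly_Mapping.single 0 s) * f"
  let ?E = "monom_poly ` ?MI \<union> range ?g"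
  have C_keys: "C \<subseteq> {m. Poly_Mapping.keys m \<subseteq> {..n}}"
    using C by (auto simp: borel_set_def monomials_def)
  note MI = keys_monomial_ideal[OF C_keys]
  have ideal: "Idl\<^bsub>poly_ring n\<^esub> (monom_poly ` C \<union> {f}) = mpoly.span ?E"
    using f by (intro genideal_eq_span[OF C_keys _ absorb]) (auto simp: poly_ring_def monomials_def)
  obtain m0 where m0: "m0 \<in> Poly_Mapping.keys f"
    using \<open>f \<noteq> 0\<close> by (metis ex_in_conv keys_eq_empty)
  have deg_g: "mdeg m = s + d" if "m \<in> Poly_Mapping.keys (?g s)" for m s
    using that f by (auto simp: keys_monom_poly_mult mdeg_add monomials_def)
  have g_key: "Poly_Mapping.single 0 s + m0 \<in> Poly_Mapping.keys (?g s)" for s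
    using m0 by (simp add: keys_monom_poly_mult)
  have dim: "vector_space.dim scale (graded_part (mpoly.span ?E) (s + d)) + card (monomials n d - C)
          = ((n + (s + d)) choose n) + 1" for s
  proof -
    let ?M = "?MI \<inter> monomials n (s + d)"
    have hom: "\<exists>t. \<forall>m\<in>Poly_Mapping.keys e. mdeg m = t" if "e \<in> ?E" for e :: "'a mpoly"
      using that deg_g by (auto simp: monom_poly_def)
    have g_graded: "?g s' \<in> graded_part ?E (s + d) \<longleftrightarrow> s' = s" for s'
      using deg_g[of _ s'] g_key[of s'] by (auto simp: graded_part_def)
    have m_graded: "monom_poly m \<in> graded_part ?E (s + d) \<longleftrightarrow> m \<in> ?M" if "m \<in> ?MI" for m
      using that MI by (auto simp: graded_part_def monomials_def monom_poly_def)
    have graded: "graded_part ?E (s + d) = insert (?g s) (monom_poly ` ?M)"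
    proof (intro equalityI subsetI)
      fix e assume e: "e \<in> graded_part ?E (s + d)"
      then have "e \<in> ?E" by (simp add: graded_part_def)
      then consider m where "e = monom_poly m" "m \<in> ?MI" | s' where "e = ?g s'" by blast
      then show "e \<in> insert (?g s) (monom_poly ` ?M)"
        by cases (use e g_graded m_graded in auto)
    next
      fix e assume "e \<in> insert (?g s) (monom_poly ` ?M)"
      then consider "e = ?g s" | m where "e = monom_poly m" "m \<in> ?M" by blast
      then show "e \<in> graded_part ?E (s + d)"
        by cases (use g_graded m_graded in auto)
    qed
    have "monomials n (s + d) - ?MI = (+) (Poly_Mapping.single 0 s) ` (monomials n d - C)"
      by (rule standard_monomials_borel[OF C \<open>d > 0\<close>]) (rule x0)
    then have "Poly_Mapping.single 0 s + m0 \<notin> ?MI"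
      using m0 f by blast
    then have notin: "?g s \<notin> mpoly.span (monom_poly ` ?M)"
      using g_key[of s] by (auto simp: span_monom_polys)
    have "graded_part (mpoly.span ?E) (s + d) = mpoly.span (insert (?g s) (monom_poly ` ?M))"
      unfolding graded[symmetric] by (rule graded_part_span) (rule hom)
    then have "vector_space.dim scale (graded_part (mpoly.span ?E) (s + d)) =
            card (insert (?g s) (monom_poly ` ?M))"
      using mpoly.dim_eq_card_independent[OF
          mpoly.independent_insertI[OF notin independent_monom_polys]]
      by (simp only: mpoly.dim_span)
    also have "\<dots> = card (monom_poly ` ?M :: 'a mpoly set) + 1"
    proof -
      have "?g s \<notin> monom_poly ` ?M" using notin by (metis mpoly.span_base)
      moreover have "finite (monom_poly ` ?M :: 'a mpoly set)"
        using finite_monomials by blast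
      ultimately show ?thesis by (simp only: card_insert_disjoint not_False_eq_True Suc_eq_plus1)
    qed
    also have "card (monom_poly ` ?M :: 'a mpoly set) = card ?M"
      by (intro card_image inj_on_subset[OF inj_monom_poly]) simp
    moreover have "card ?M + card (monomials n d - C) = (n + (s + d)) choose n"
      by (rule card_monomial_ideal_borel[OF C \<open>d > 0\<close>]) (rule x0)
    ultimately show ?thesis by simp
  qed
  have "of_nat (vector_space.dim scale (graded_part (mpoly.span ?E) t)) =
      poly (binom_poly n + 1 - [:of_nat (card (monomials n d - C)):]) (of_nat t)"
    if "t \<ge> d" for t
  proof -
    have "(of_nat (vector_space.dim scale (graded_part (mpoly.span ?E) t)) :: rat)
        + of_nat (card (monomials n d - C)) = of_nat ((n + t) choose n) + 1"
      using arg_cong[OF dim[of "t - d"], of "of_nat :: nat \<Rightarrow> rat"] that by simp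
    then show ?thesis
      by (simp add: poly_binom_poly algebra_simps)
  qed
  then show ?thesis
    unfolding has_hilbert_poly_def ideal eventually_sequentially by blast
qed

theorem theorem3p2:
  fixes n d :: nat
    and B N :: "monomial set"
    and \<alpha> \<beta> :: monomial
    and y0 y1 :: "'k::{alg_closed_field, field_char_0}"
  assumes "d > 0"
    and "borel_set n d B"
    and "N = monomials n d - B"
    and "card (min_var_ge N 0) = d"
    and "\<forall>j. 0 < j \<and> j < n \<longrightarrow> min_var_ge N j = {}"
    and "minimal_in n B N \<alpha>"
    and "maximal_in n B N \<beta>"
    and "min_var \<alpha> = 0"
    and "\<forall>j. adm_minus n j \<alpha> \<longrightarrow> e_minus j \<alpha> \<noteq> \<beta>"
    and "(y0, y1) \<noteq> (0, 0)"
  shows "has_hilbert_poly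
           (Idl\<^bsub>poly_ring n\<^esub> (monom_poly ` (B - {\<alpha>}) \<union>
              {scale y0 (monom_poly \<alpha>) + scale y1 (monom_poly \<beta>)}))
           (binom_poly n - [:of_nat d:])"
proof -
  note B = assms(2) and N = assms(3)
  let ?C = "B - {\<alpha>}"
  let ?f = "scale y0 (monom_poly \<alpha>) + scale y1 (monom_poly \<beta>)"
  have \<alpha>B: "\<alpha> \<in> B" and \<beta>N: "\<beta> \<in> N"
    using assms(6,7) by (auto simp: minimal_in_def maximal_in_def)
  have neq: "\<alpha> \<noteq> \<beta>" using \<alpha>B \<beta>N N by blast
  have \<alpha>mon: "\<alpha> \<in> monomials n d" and \<beta>mon: "\<beta> \<in> monomials n d"
    using B \<alpha>B \<beta>N N by (auto simp: borel_set_def)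
  have nonempty: "Poly_Mapping.keys m \<noteq> {}" if "m \<in> monomials n d" for m
    using that \<open>d > 0\<close> by (auto simp: monomials_def mdeg_def)
  have \<alpha>0: "0 \<in> Poly_Mapping.keys \<alpha>"
    using Min_in[OF finite_keys nonempty[OF \<alpha>mon]] assms(8) by (simp add: min_var_def)
  have N0: "0 \<in> Poly_Mapping.keys m" if m: "m \<in> N" for m
  proof (rule ccontr)
    assume 0: "0 \<notin> Poly_Mapping.keys m"
    have m_mon: "m \<in> monomials n d" and "m \<notin> B" using m N by auto
    have m_keys: "Poly_Mapping.keys m \<subseteq> {1..n}"
      using m_mon 0 by (auto simp: monomials_def Suc_le_eq intro: gr0I)
    then have "n \<ge> 1" using nonempty[OF m_mon] by (cases n) (auto simp del: keys_eq_empty)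
    have "min_var m \<ge> 1"
      using Min_in[OF finite_keys nonempty[OF m_mon]] m_keys by (auto simp: min_var_def)
    with m have "m \<in> min_var_ge N 1" by (simp add: min_var_ge_def)
    with assms(5) \<open>n \<ge> 1\<close> have "n = 1" by (metis empty_iff le_neq_implies_less zero_less_one)
    \<comment> \<open>In two variables \<open>m\<close> can only be the power of \<open>x\<^sub>1\<close>, which increasing moves reach from \<open>\<alpha>\<close>.\<close>
    have "m = Poly_Mapping.single 1 (Poly_Mapping.lookup m 1)"
      using m_keys \<open>n = 1\<close>
      by (intro poly_mapping_eqI) (auto simp: lookup_single when_def in_keys_iff)
    then obtain k where "m = Poly_Mapping.single 1 k" by blast
    then have "m = Poly_Mapping.single n d"
      using m_mon \<open>n = 1\<close> by (simp add: monomials_def)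
    with borel_top_power[OF B \<alpha>B] \<open>m \<notin> B\<close> show False by simp
  qed
  have C: "borel_set n d ?C"
    by (rule borel_set_minus_minimal[OF B assms(6)]) (use N in blast)
  have compl: "monomials n d - ?C = insert \<alpha> N"
    using \<alpha>mon N \<alpha>B by blast
  have "min_var_ge N 0 = N" by (simp add: min_var_ge_def)
  moreover have "finite N" unfolding N using finite_monomials by blast
  ultimately have card: "card (monomials n d - ?C) = d + 1"
    unfolding compl using assms(4) N \<alpha>B by simp
  have lookup_f: "Poly_Mapping.lookup ?f m =
      (if m = \<alpha> then y0 else if m = \<beta> then y1 else 0)" for m
    using neq by (simp add: lookup_add lookup_scale monom_poly_def lookup_single when_def)
  have keys_f: "Poly_Mapping.keys ?f \<subseteq> {\<alpha>, \<beta>}"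
    by (auto simp: in_keys_iff lookup_f split: if_splits)
  have "?f \<noteq> 0"
    using lookup_f[of \<alpha>] lookup_f[of \<beta>] neq assms(10) by auto
  have absorb: "Poly_Mapping.single i 1 + m \<in> monomial_ideal n ?C"
    if i: "0 < i" "i \<le> n" and m: "m \<in> Poly_Mapping.keys ?f" for i m
  proof -
    have "m = \<alpha> \<or> m = \<beta>" using m keys_f by blast
    then have "0 \<in> Poly_Mapping.keys m" using \<alpha>0 N0 \<beta>N by blast
    then obtain m' where m': "m = Poly_Mapping.single 0 1 + m'"
      by (rule split_off_variable)
    have step: "adm_plus n 0 m" "e_plus 0 m = Poly_Mapping.single 1 1 + m'"
      using i m' e_plus_split[of 0 m'] by (simp_all add: adm_plus_def keys_add_monomial)
    \<comment> \<open>It suffices to treat \<open>i = 1\<close>, as \<open>C\<close> is closed under the moves from \<open>x\<^sub>1\<close> to \<open>x\<^sub>i\<close>.\<close>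
    have "Poly_Mapping.single 1 1 + m' \<in> ?C"
    proof
      show "Poly_Mapping.single 1 1 + m' \<in> B"
        using \<open>m = \<alpha> \<or> m = \<beta>\<close> step assms(7) B \<alpha>B
        unfolding borel_set_def maximal_in_def by metis
      show "Poly_Mapping.single 1 1 + m' \<notin> {\<alpha>}"
      proof
        assume "Poly_Mapping.single 1 1 + m' \<in> {\<alpha>}"
        then have \<alpha>: "\<alpha> = Poly_Mapping.single 1 1 + m'" by simp
        then have "adm_minus n 1 \<alpha>" "e_minus 1 \<alpha> = m"
          using i m' e_minus_split[of 0 m'] by (simp_all add: adm_minus_def keys_add_monomial)
        moreover have "m \<noteq> \<alpha>"
          using \<alpha> m' by (metis add_right_cancel lookup_single_eq lookup_single_not_eq zero_neq_one)
        ultimately show False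
          using \<open>m = \<alpha> \<or> m = \<beta>\<close> assms(9) by blast
      qed
    qed
    then have "Poly_Mapping.single i 1 + m' \<in> ?C"
      using borel_raise[OF C, of 1 m' i] i by simp
    then have "Poly_Mapping.single 0 1 + (Poly_Mapping.single i 1 + m') \<in> monomial_ideal n ?C"
      unfolding monomial_ideal_def by fastforce
    then show ?thesis using m' by (simp add: ac_simps)
  qed
  have "has_hilbert_poly (Idl\<^bsub>poly_ring n\<^esub> (monom_poly ` ?C \<union> {?f}))
      (binom_poly n + 1 - [:of_nat (card (monomials n d - ?C)):])"
  proof (rule hilbert_poly_borel_plus_form[OF C \<open>d > 0\<close> _ \<open>?f \<noteq> 0\<close> _ absorb])
    show "0 \<in> Poly_Mapping.keys m" if "m \<in> monomials n d - ?C" for m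
      using that \<alpha>0 N0 unfolding compl by blast
    show "Poly_Mapping.keys ?f \<subseteq> monomials n d - ?C"
      using keys_f \<beta>N unfolding compl by blast
  qed
  moreover have "binom_poly n + 1 - [:of_nat (card (monomials n d - ?C)):]
      = binom_poly n - [:of_nat d:]"
    unfolding card by (simp add: one_pCons)
  ultimately show ?thesis by simp
qed

end
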